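(* Let $p_{\ell,w}$ be the probability that a growing self-avoiding walk (GSAW) on the bi-infinite ladder graph $L_\infty$ terminates having taken exactly $\ell$ steps and having width $w$. Let $L_\infty(x,y)=\sum_{\ell\ge 0}\sum_{w\ge 0}p_{\ell,w}x^\ell y^w$ be its bivariate ordinary generating function. Then, as formal power series, $$L_\infty(x,y)=\frac{x^5y^2(4-x^3y^2)}{3(x^2y-2)^2(x^3y^2-4x^2y-4xy+8)}.$$
   Context: $L_\infty$ is the graph with vertex set $\{(a,b): a\in\mathbb{Z},\ b\in\{1,2\}\}$, where $(a,b)$ and $(a',b')$ are adjacent iff ($b=b'$ and $|a-a'|=1$) or ($a=a'$ and $b\ne b'$). All starting vertices are equivalent by symmetry. A growing self-avoiding walk (GSAW) on a graph is the random process that starts at a given vertex and at each step moves to a vertex chosen uniformly at random among the neighbors of the current vertex that have not yet been visited; it terminates (is trapped) when the current vertex has no unvisited neighbor. The length of the walk is the number of steps taken. The width of the walk is the difference between the largest and smallest first coordinates ($x$-coordinates) of the vertices visited. *)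

theory Defs
  imports "HOL-Probability.Probability"
    "HOL-Computational_Algebra.Formal_Power_Series"
begin

section \<open>Growing self-avoiding walks\<close>

text \<open>
  A walk is the list of the visited vertices in order of visit, so its length (number of
  steps) is one less than the length of the list.
\<close>

definition unvisited_nbrs :: "'v set \<Rightarrow> ('v \<Rightarrow> 'v \<Rightarrow> bool) \<Rightarrow> 'v list \<Rightarrow> 'v set" where
  "unvisited_nbrs V adj p = {u \<in> V. adj (last p) u \<and> u \<notin> set p}"

definition trapped :: "'v set \<Rightarrow> ('v \<Rightarrow> 'v \<Rightarrow> bool) \<Rightarrow> 'v list \<Rightarrow> bool" where
  "trapped V adj p \<longleftrightarrow> unvisited_nbrs V adj p = {}"

text \<open>
  The graph has to be locally finite, because \<^const>\<open>pmf_of_set\<close> is the uniform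
  distribution only on finite nonempty sets.
\<close>

definition gsaw_step :: "'v set \<Rightarrow> ('v \<Rightarrow> 'v \<Rightarrow> bool) \<Rightarrow> 'v list \<Rightarrow> 'v list pmf" where
  "gsaw_step V adj p =
     (if trapped V adj p then return_pmf p
      else map_pmf (\<lambda>u. p @ [u]) (pmf_of_set (unvisited_nbrs V adj p)))"

text \<open>
  The law of the walk started at \<open>v\<close>, observed at time \<open>n\<close>; a walk that is trapped earlier
  is kept unchanged.
\<close>

primrec gsaw :: "'v set \<Rightarrow> ('v \<Rightarrow> 'v \<Rightarrow> bool) \<Rightarrow> 'v \<Rightarrow> nat \<Rightarrow> 'v list pmf" where
  "gsaw V adj v 0 = return_pmf [v]"
| "gsaw V adj v (Suc n) = bind_pmf (gsaw V adj v n) (gsaw_step V adj)"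

section \<open>The bi-infinite ladder\<close>

definition ladder_verts :: "(int \<times> nat) set" where
  "ladder_verts = UNIV \<times> {1, 2}"

definition ladder_adj :: "int \<times> nat \<Rightarrow> int \<times> nat \<Rightarrow> bool" where
  "ladder_adj u v \<longleftrightarrow>
     (snd u = snd v \<and> \<bar>fst u - fst v\<bar> = 1) \<or> (fst u = fst v \<and> snd u \<noteq> snd v)"

lemma finite_ladder_nbrs: "finite {v \<in> ladder_verts. ladder_adj u v}"
proof (rule finite_subset)
  show "{v \<in> ladder_verts. ladder_adj u v} \<subseteq> {fst u - 1 .. fst u + 1} \<times> {1, 2}"
    by (auto simp: ladder_verts_def ladder_adj_def)
qed simp

definition walk_width :: "(int \<times> 'b) list \<Rightarrow> int" where
  "walk_width p = Max (fst ` set p) - Min (fst ` set p)"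

text \<open>
  At time \<open>l\<close> the list has \<open>l + 1\<close> entries exactly if the walk was not trapped before
  time \<open>l\<close>, so this is the probability of termination after exactly \<open>l\<close> steps with width \<open>w\<close>.
\<close>

definition ladder_prob :: "int \<times> nat \<Rightarrow> nat \<Rightarrow> nat \<Rightarrow> real" where
  "ladder_prob v l w =
     measure_pmf.prob (gsaw ladder_verts ladder_adj v l)
       {p. length p = l + 1 \<and> trapped ladder_verts ladder_adj p \<and> walk_width p = int w}"

section \<open>Bivariate power series\<close>

text \<open>
  \<open>\<real>[[x,y]]\<close> is represented as \<open>\<real>[[y]][[x]]\<close>: the outer variable is \<open>x\<close>, the inner one is \<open>y\<close>.
\<close>

abbreviation X :: "real fps fps" where "X \<equiv> fps_X"
abbreviation Y :: "real fps fps" where "Y \<equiv> fps_const fps_X"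

definition ladder_gf :: "int \<times> nat \<Rightarrow> real fps fps" where
  "ladder_gf v = Abs_fps (\<lambda>l. Abs_fps (\<lambda>w. ladder_prob v l w))"

text \<open>
  Division of bivariate power series by a series with nonzero constant term is the
  division by a unit.
\<close>

lemma bivariate_divide_eq_iff:
  fixes F G D :: "real fps fps"
  assumes "fps_nth (fps_nth D 0) 0 \<noteq> 0"
  shows "F = G / D \<longleftrightarrow> F * D = G"
proof -
  have D0: "fps_nth D 0 \<noteq> 0"
    using assms by auto
  have u: "inverse (fps_nth D 0) * fps_nth D 0 = 1"
    using assms by (simp add: inverse_mult_eq_1)
  have inv: "inverse D * D = 1"
    unfolding fps_inverse_def[of D]
    by (subst mult.commute, rule fps_right_inverse) (use u in \<open>simp add: mult.commute\<close>)
  have "G / D = G * inverse D"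
    using D0 by (simp add: fps_divide_def)
  then show ?thesis
    using inv by (metis (no_types, lifting) mult.assoc mult.commute mult.right_neutral)
qed

end

theory Submission
  imports Defs
begin

text \<open>
  Attach to every partial walk \<open>p\<close> the generating function \<open>G p\<close> of its completions, where \<open>x\<close>
  counts the steps still to be made and \<open>y\<close> records the width of the finished walk. Conditioning
  on the next step gives \<open>k * G p = x * (G p\<^sub>1 + \<dots> + G p\<^sub>k)\<close>, where the \<open>p\<^sub>i\<close> are the \<open>k\<close>
  one-step extensions of \<open>p\<close>, and \<open>G p = y ^ w\<close> if \<open>p\<close> is trapped with width \<open>w\<close>.

  On the ladder the walk is nearly forced, and up to reflections only three shapes matter.

  \<^item> Once it is cut off from the side it came from, the walk is at the front of the visited region
    whenever it enters a new column, and all that matters is the number \<open>r\<close> of free cells behind it in the other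
    row. It can move on (\<open>r\<close> grows by one), or change rows and move on (\<open>r\<close> becomes \<open>0\<close>), or, if
    \<open>r > 0\<close>, change rows and turn back; then it fills the dead end of \<open>r\<close> cells and is trapped.
    Write \<open>R\<^sub>r\<close> for \<open>G p / y ^ w\<close>, with \<open>w\<close> the current width. Then
    \<open>2 R\<^sub>0 = x y R\<^sub>1 + x\<^sup>2 y R\<^sub>0\<close> and \<open>4 R\<^sub>r = 2 x y R\<^sub>r\<^sub>+\<^sub>1 + x\<^sup>2 (y R\<^sub>0 + x\<^sup>r\<^sup>-\<^sup>1)\<close> for \<open>r > 0\<close>.

  \<^item> The walk may first run straight for \<open>k > 0\<close> steps. If it then changes rows and turns back, the
    other row is a corridor that is open at its far end: the walk is forced through it, leaves
    the visited region on the far side, and is at a front with \<open>r = 0\<close>. So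
    \<open>4 S\<^sub>k = 2 x y S\<^sub>k\<^sub>+\<^sub>1 + x\<^sup>2 y (1 + x\<^sup>k) R\<^sub>0\<close>.

  \<^item> The first step is along the ladder (two cases, leading to \<open>S\<^sub>1\<close>) or across it (leading to \<open>R\<^sub>0\<close>
    after the second step).

  These linear systems are infinite, but all unknowns on the right carry a factor \<open>x\<close>, so their
  solution in power series is unique. It therefore suffices to exhibit a solution over a common
  denominator (\<open>front_num\<close>, \<open>straight_num\<close>) and to check polynomial identities. The geometric
  content is in \<open>completion_gf_front\<close> and \<open>completion_gf_straight\<close>, the uniqueness argument
  in \<open>front_gf_mod\<close> and \<open>straight_gf_mod\<close>.
\<close>
section \<open>Completing a partial walk\<close>

text \<open>
  The same process as \<^const>\<open>gsaw\<close>, but unfolded at its first step and started from any partial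
  walk. This is the form in which one can condition on the next step.
\<close>
primrec gsaw_from :: "'v set \<Rightarrow> ('v \<Rightarrow> 'v \<Rightarrow> bool) \<Rightarrow> nat \<Rightarrow> 'v list \<Rightarrow> 'v list pmf" where
  "gsaw_from V adj 0 p = return_pmf p"
| "gsaw_from V adj (Suc n) p = bind_pmf (gsaw_step V adj p) (gsaw_from V adj n)"

lemma gsaw_from_Suc_end:
  "gsaw_from V adj (Suc n) p = bind_pmf (gsaw_from V adj n p) (gsaw_step V adj)"
proof (induction n arbitrary: p)
  case 0
  have "gsaw_from V adj 0 = return_pmf"
    by (simp add: fun_eq_iff)
  then show ?case by (simp add: bind_return_pmf bind_return_pmf')
next
  case (Suc n)
  have "gsaw_from V adj (Suc (Suc n)) p
      = bind_pmf (gsaw_step V adj p) (gsaw_from V adj (Suc n))"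
    by (rule gsaw_from.simps)
  also have "\<dots> = bind_pmf (gsaw_step V adj p)
      (\<lambda>q. bind_pmf (gsaw_from V adj n q) (gsaw_step V adj))"
    using Suc.IH by (intro bind_pmf_cong refl)
  finally show ?case by (simp add: bind_assoc_pmf)
qed

lemma gsaw_eq_gsaw_from: "gsaw V adj v n = gsaw_from V adj n [v]"
  by (induction n) (simp_all only: gsaw.simps gsaw_from_Suc_end gsaw_from.simps(1))

lemma gsaw_from_trapped:
  assumes "trapped V adj p"
  shows "gsaw_from V adj n p = return_pmf p"
  by (induction n) (simp_all add: assms gsaw_step_def bind_return_pmf)

abbreviation stuck :: "(int \<times> nat) list \<Rightarrow> bool" where
  "stuck \<equiv> trapped ladder_verts ladder_adj"

abbreviation free_nbrs :: "(int \<times> nat) list \<Rightarrow> (int \<times> nat) set" where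
  "free_nbrs \<equiv> unvisited_nbrs ladder_verts ladder_adj"

text \<open>
  The length condition excludes the walks that are trapped before \<open>l\<close> further steps, which the
  process keeps unchanged.
\<close>
definition completion_prob :: "(int \<times> nat) list \<Rightarrow> nat \<Rightarrow> nat \<Rightarrow> real" where
  "completion_prob p l w = measure_pmf.prob (gsaw_from ladder_verts ladder_adj l p)
     {q. length q = length p + l \<and> stuck q \<and> walk_width q = int w}"

definition completion_gf :: "(int \<times> nat) list \<Rightarrow> real fps fps" where
  "completion_gf p = Abs_fps (\<lambda>l. Abs_fps (\<lambda>w. completion_prob p l w))"

lemma ladder_gf_eq_completion_gf: "ladder_gf v = completion_gf [v]"
  by (simp add: ladder_gf_def completion_gf_def ladder_prob_def completion_prob_def
      gsaw_eq_gsaw_from add.commute)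

lemma finite_free_nbrs: "finite (free_nbrs p)"
  by (rule finite_subset[OF _ finite_ladder_nbrs[of "last p"]]) (auto simp: unvisited_nbrs_def)

lemma prob_bind_pmf:
  "measure_pmf.prob (bind_pmf M f) A = measure_pmf.expectation M (\<lambda>x. measure_pmf.prob (f x) A)"
  unfolding measure_pmf_bind
  by (subst measure_pmf.measure_bind[where N="count_space UNIV"])
    (auto simp: measurable_def space_subprob_algebra measure_pmf.subprob_space_axioms)

lemma completion_prob_0:
  "completion_prob p 0 w = (if stuck p \<and> walk_width p = int w then 1 else 0)"
  by (simp add: completion_prob_def measure_return_pmf indicator_def)

lemma completion_prob_Suc:
  "completion_prob p (Suc l) w =
     (if stuck p then 0
      else (\<Sum>u\<in>free_nbrs p. completion_prob (p @ [u]) l w) / card (free_nbrs p))"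
proof (cases "stuck p")
  case True
  then show ?thesis
    by (simp add: completion_prob_def gsaw_from_trapped measure_return_pmf indicator_def
        del: gsaw_from.simps)
next
  case False
  have ne: "free_nbrs p \<noteq> {}"
    using False by (simp add: trapped_def)
  show ?thesis
    using False finite_free_nbrs[of p] ne
    by (simp add: completion_prob_def gsaw_step_def prob_bind_pmf integral_pmf_of_set)
qed

lemma completion_gf_stuck:
  assumes "stuck p" "walk_width p = int w"
  shows "completion_gf p = Y ^ w"
proof -
  have "completion_prob p l m = (if l = 0 \<and> m = w then 1 else 0)" for l m
    using assms by (cases l) (auto simp: completion_prob_0 completion_prob_Suc)
  then show ?thesis
    by (auto simp: completion_gf_def fps_eq_iff fps_X_power_nth)
qed

text \<open>
  Conditioning on the next step. The number of free neighbours is kept as a factor on the left,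
  so that no inverses of scalars are needed among the bivariate series.
\<close>
lemma completion_gf_step:
  assumes "free_nbrs p \<noteq> {}"
  shows "of_nat (card (free_nbrs p)) * completion_gf p
    = X * (\<Sum>u\<in>free_nbrs p. completion_gf (p @ [u]))"
proof -
  have ns: "\<not> stuck p" using assms by (simp add: trapped_def)
  have c: "card (free_nbrs p) \<noteq> 0" using assms finite_free_nbrs by simp
  have n: "fps_nth (fps_nth (of_nat k * F) l) w = of_nat k * fps_nth (fps_nth F l) w"
    for k l w and F :: "real fps fps"
    by (simp add: fps_of_nat[symmetric])
  show ?thesis
    unfolding fps_eq_iff
  proof (intro allI)
    fix l w
    show "fps_nth (fps_nth (of_nat (card (free_nbrs p)) * completion_gf p) l) w =
       fps_nth (fps_nth (X * (\<Sum>u\<in>free_nbrs p. completion_gf (p @ [u]))) l) w"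
      unfolding n using ns c
      by (cases l) (simp_all add: completion_gf_def completion_prob_0 completion_prob_Suc
        fps_sum_nth)
  qed
qed

section \<open>Geometry of walks on the ladder\<close>

text \<open>
  From here on a direction \<open>e \<in> {1, -1}\<close> is carried along, which treats a configuration and its
  left-right mirror image together. Since the rows are \<open>1\<close> and \<open>2\<close>, the other row is \<open>3 - b\<close>.
\<close>
lemma free_nbrs_ladder:
  assumes "last p = (c, b)" "b \<in> {1, 2}" "e \<in> {1, -1}"
  shows "free_nbrs p = {(c + e, b), (c - e, b), (c, 3 - b)} - set p"
  using assms by (auto simp: unvisited_nbrs_def ladder_verts_def ladder_adj_def)

lemma walk_width_snoc_old_column:
  assumes "fst u \<in> fst ` set p"
  shows "walk_width (p @ [u]) = walk_width p"
  using assms by (simp add: walk_width_def insert_absorb)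

lemma walk_width_snoc_new_column:
  assumes "e \<in> {1, -1}" "c \<in> fst ` set p" "\<forall>u\<in>set p. e * fst u \<le> e * c"
  shows "walk_width (p @ [(c + e, b)]) = walk_width p + 1"
proof -
  define A where "A = fst ` set p"
  have A: "finite A" "A \<noteq> {}" "c \<in> A" "\<forall>a\<in>A. e * a \<le> e * c"
    using assms by (auto simp: A_def)
  have w: "walk_width (p @ [(c + e, b)]) = Max (insert (c + e) A) - Min (insert (c + e) A)"
    "walk_width p = Max A - Min A"
    by (simp_all add: walk_width_def A_def)
  consider "e = 1" | "e = -1" using assms(1) by blast
  then show ?thesis
  proof cases
    case 1
    then have "Max A = c" using A by (intro Max_eqI) auto
    moreover have "Min A \<le> c" using A by auto
    ultimately show ?thesis unfolding w using 1 A by simp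
  next
    case 2
    then have "Min A = c" using A by (intro Min_eqI) auto
    moreover have "c \<le> Max A" using A by auto
    ultimately have "max (c - 1) (Max A) = Max A" by linarith
    then show ?thesis unfolding w using 2 A \<open>Min A = c\<close> by simp
  qed
qed

text \<open>
  The walk enters, in direction \<open>e\<close>, a stretch of \<open>j\<close> free cells along which the other row is
  already visited. Nothing is said about the cell after the stretch: it decides whether the
  corridor is a dead end or an exit.
\<close>
definition corridor :: "int \<Rightarrow> nat \<Rightarrow> int \<Rightarrow> nat \<Rightarrow> (int \<times> nat) list \<Rightarrow> bool" where
  "corridor e j c b p \<longleftrightarrow> p \<noteq> [] \<and> last p = (c, b) \<and> b \<in> {1, 2} \<and> e \<in> {1, -1}
     \<and> (c - e, b) \<in> set p
     \<and> (\<forall>i\<in>{1..int j}. (c + e * i, b) \<notin> set p)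
     \<and> (\<forall>i\<in>{0..int j}. (c + e * i, 3 - b) \<in> set p)"

lemma corridor_step:
  assumes "corridor e (Suc j) c b p"
  shows "completion_gf p = X * completion_gf (p @ [(c + e, b)])"
    and "corridor e j (c + e) b (p @ [(c + e, b)])"
    and "walk_width (p @ [(c + e, b)]) = walk_width p"
proof -
  note C = assms[unfolded corridor_def]
  have free: "(c + e * i, b) \<notin> set p" if "1 \<le> i" "i \<le> int j + 1" for i
    using C that by auto
  have full: "(c + e * i, 3 - b) \<in> set p" if "0 \<le> i" "i \<le> int j + 1" for i
    using C that by auto
  have "free_nbrs p = {(c + e, b)}"
    using C free[of 1] full[of 0] by (subst free_nbrs_ladder[of p c b e]) auto
  then show "completion_gf p = X * completion_gf (p @ [(c + e, b)])"
    using completion_gf_step[of p] by simp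
  have "fst (c + e, b) \<in> fst ` set p"
    using full[of 1] by (force simp: image_iff)
  then show "walk_width (p @ [(c + e, b)]) = walk_width p"
    by (rule walk_width_snoc_old_column)
  have "(c + e + e * i, b) \<notin> set p" if "1 \<le> i" "i \<le> int j" for i
    using free[of "i + 1"] that C by (auto simp: algebra_simps)
  moreover have "(c + e + e * i, 3 - b) \<in> set p" if "0 \<le> i" "i \<le> int j" for i
    using full[of "i + 1"] that by (auto simp: algebra_simps)
  moreover have "(c, b) \<in> set p"
    using C last_in_set by metis
  moreover have "e \<noteq> 0" using C by auto
  ultimately show "corridor e j (c + e) b (p @ [(c + e, b)])"
    using C by (simp add: corridor_def)
qed

text \<open>
  Each step in a corridor is forced and stays in a column visited before, so it costs a
  factor \<open>x\<close> and does not affect the width; the walk is trapped at the closed end.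
\<close>
lemma completion_gf_dead_end:
  assumes "corridor e j c b p" "(c + e * (int j + 1), b) \<in> set p" "walk_width p = int w"
  shows "completion_gf p = X ^ j * Y ^ w"
  using assms
proof (induction j arbitrary: c p)
  case 0
  then have "free_nbrs p = {}"
    by (subst free_nbrs_ladder[of p c b e]) (auto simp: corridor_def)
  then show ?case
    using completion_gf_stuck[of p w] 0 by (simp add: trapped_def)
next
  case (Suc j)
  note s = corridor_step[OF Suc.prems(1)]
  have "completion_gf (p @ [(c + e, b)]) = X ^ j * Y ^ w"
    using Suc.prems(2,3) s(3) by (intro Suc.IH[OF s(2)]) (auto simp: algebra_simps)
  then show ?case
    using s(1) by (simp add: mult.assoc)
qed

text \<open>
  The walk is alone in the outermost column in direction \<open>e\<close>. Behind it, the other row has \<open>r\<close>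
  free cells followed by a visited one, so this row is closed off for good. The visited cells
  in its own row reach one column further than the free ones, up to \<open>r + 1\<close>: for \<open>r = 0\<close> this
  says that the walk came from the column behind it.
\<close>
definition front :: "int \<Rightarrow> nat \<Rightarrow> int \<Rightarrow> nat \<Rightarrow> (int \<times> nat) list \<Rightarrow> bool" where
  "front e r c b p \<longleftrightarrow> p \<noteq> [] \<and> last p = (c, b) \<and> b \<in> {1, 2} \<and> e \<in> {1, -1}
     \<and> (\<forall>u\<in>set p. u = (c, b) \<or> e * fst u < e * c)
     \<and> (\<forall>i\<in>{0..int r + 1}. (c - e * i, b) \<in> set p)
     \<and> (\<forall>i\<in>{1..int r}. (c - e * i, 3 - b) \<notin> set p)
     \<and> (c - e * (int r + 1), 3 - b) \<in> set p"

text \<open>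
  If no visited cell lies beyond the end of the corridor, then the walk is forced through it and
  one step further into a new column. There it is at a front with no free cell behind it, since
  both cells of the column it has just left are visited. Hence the exponent \<open>j + 1\<close> and the
  width \<open>w + 1\<close>.
\<close>
lemma completion_gf_escape:
  assumes "corridor e j c b p" "\<forall>u\<in>set p. e * fst u \<le> e * (c + e * int j)" "walk_width p = int w"
  shows "\<exists>q c. front e 0 c b q \<and> walk_width q = int (Suc w)
    \<and> completion_gf p = X ^ Suc j * completion_gf q"
  using assms
proof (induction j arbitrary: c p)
  case 0
  have C: "p \<noteq> []" "last p = (c, b)" "b \<in> {1, 2}" and e: "e \<in> {1, -1}"
    and visited: "(c - e, b) \<in> set p" "(c, 3 - b) \<in> set p"
    using 0(1) by (simp_all add: corridor_def)
  let ?q = "p @ [(c + e, b)]"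
  have le: "\<forall>u\<in>set p. e * fst u \<le> e * c"
    using 0(2) by simp
  have cb: "(c, b) \<in> set p"
    using C(1,2) last_in_set by metis
  have new: "(c + e, b') \<notin> set p" for b'
    using le e by force
  have "free_nbrs p = {(c + e, b)}"
    using visited new by (subst free_nbrs_ladder[OF C(2,3) e]) auto
  then have gf: "completion_gf p = X * completion_gf ?q"
    using completion_gf_step[of p] by simp
  have "c \<in> fst ` set p"
    using cb by (rule image_eqI[rotated]) simp
  then have w: "walk_width ?q = int (Suc w)"
    using walk_width_snoc_new_column[OF e _ le] 0(3) by simp
  have lt: "e * fst u < e * (c + e)" if "u \<in> set p" for u
    using bspec[OF le that] e by auto
  have "i = 0 \<or> i = 1" if "i \<in> {0..1}" for i :: int
    using that by auto
  then have "(c + e - e * i, b) \<in> set ?q" if "i \<in> {0..1}" for i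
    using cb that by force
  then have "front e 0 (c + e) b ?q"
    using C e lt visited unfolding front_def by simp
  then show ?case
    using gf w by (intro exI[of _ ?q] exI[of _ "c + e"] conjI) simp_all
next
  case (Suc j)
  note s = corridor_step[OF Suc.prems(1)]
  have e: "e \<in> {1, -1}" using Suc.prems(1) by (simp add: corridor_def)
  have "\<exists>q d. front e 0 d b q \<and> walk_width q = int (Suc w)
    \<and> completion_gf (p @ [(c + e, b)]) = X ^ Suc j * completion_gf q"
  proof (rule Suc.IH[OF s(2)])
    have "e * fst u \<le> e * (c + e + e * int j)" if "u \<in> set p" for u
      using Suc.prems(2) that by (auto simp: algebra_simps)
    moreover have "e * (c + e) \<le> e * (c + e + e * int j)"
      using e by auto
    ultimately show "\<forall>u\<in>set (p @ [(c + e, b)]). e * fst u \<le> e * (c + e + e * int j)"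
      by auto
    show "walk_width (p @ [(c + e, b)]) = int w"
      using s(3) Suc.prems(3) by simp
  qed
  then obtain q d where q: "front e 0 d b q" "walk_width q = int (Suc w)"
    "completion_gf (p @ [(c + e, b)]) = X ^ Suc j * completion_gf q"
    by blast
  have "completion_gf p = X ^ Suc (Suc j) * completion_gf q"
    using s(1) q(3) by (simp add: mult.assoc)
  then show ?case
    using q(1,2) by blast
qed

lemma front_advance:
  assumes "front e r c b p"
  shows "front e (Suc r) (c + e) b (p @ [(c + e, b)])"
    and "walk_width (p @ [(c + e, b)]) = walk_width p + 1"
proof -
  have F: "p \<noteq> []" "last p = (c, b)" and b: "b \<in> {1, 2}" and e: "e \<in> {1, -1}"
    and edge: "\<forall>u\<in>set p. u = (c, b) \<or> e * fst u < e * c"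
    and row: "\<forall>i\<in>{0..int r + 1}. (c - e * i, b) \<in> set p"
    and gap: "\<forall>i\<in>{1..int r}. (c - e * i, 3 - b) \<notin> set p"
    and wall: "(c - e * (int r + 1), 3 - b) \<in> set p"
    using assms unfolding front_def by blast+
  have cb: "(c, b) \<in> set p"
    using F last_in_set by metis
  have le: "\<forall>u\<in>set p. e * fst u \<le> e * c"
    using edge by force
  have "c \<in> fst ` set p"
    using cb by (rule image_eqI[rotated]) simp
  then show "walk_width (p @ [(c + e, b)]) = walk_width p + 1"
    using walk_width_snoc_new_column[OF e _ le] by blast
  have b': "3 - b \<noteq> b" using b by auto
  have "e * fst u < e * (c + e)" if "u \<in> set p" for u
    using bspec[OF le that] e by auto
  then have edge': "\<forall>u\<in>set (p @ [(c + e, b)]). u = (c + e, b) \<or> e * fst u < e * (c + e)"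
    by auto
  have row': "(c + e - e * i, b) \<in> set (p @ [(c + e, b)])" if "i \<in> {0..int (Suc r) + 1}" for i
  proof (cases "i = 0")
    case False
    then have "(c - e * (i - 1), b) \<in> set p"
      using that by (intro bspec[OF row]) simp
    then show ?thesis by (simp add: algebra_simps)
  qed simp
  have gap': "(c + e - e * i, 3 - b) \<notin> set (p @ [(c + e, b)])" if "i \<in> {1..int (Suc r)}" for i
  proof -
    have "(c - e * (i - 1), 3 - b) \<notin> set p"
    proof (cases "i = 1")
      case True
      then show ?thesis using edge b' by force
    next
      case False
      then show ?thesis using that by (intro bspec[OF gap]) simp
    qed
    then show ?thesis using b' by (simp add: algebra_simps)
  qed
  have wall': "(c + e - e * (int (Suc r) + 1), 3 - b) \<in> set (p @ [(c + e, b)])"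
    using wall by (simp add: algebra_simps)
  show "front e (Suc r) (c + e) b (p @ [(c + e, b)])"
    unfolding front_def
    using b e edge' row' gap' wall' by (intro conjI ballI) (simp_all only: append_is_Nil_conv last_snoc, simp_all)
qed

text \<open>
  Changing rows in the outermost column and moving on fills both cells of that column, so
  whatever lies further behind becomes unreachable.
\<close>
lemma front_after_switch:
  assumes "last p = (c, b)" "p \<noteq> []" "b \<in> {1, 2}" "e \<in> {1, -1}"
    and le: "\<forall>u\<in>set p. e * fst u \<le> e * c" and w: "walk_width p = int w"
  shows "front e 0 (c + e) (3 - b) (p @ [(c, 3 - b), (c + e, 3 - b)])"
    and "walk_width (p @ [(c, 3 - b), (c + e, 3 - b)]) = int (Suc w)"
    and "walk_width (p @ [(c, 3 - b)]) = int w"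
proof -
  have cb: "(c, b) \<in> set p"
    using assms last_in_set by metis
  have "fst (c, 3 - b) \<in> fst ` set p"
    using cb by (force simp: image_iff)
  then show w': "walk_width (p @ [(c, 3 - b)]) = int w"
    using w walk_width_snoc_old_column by metis
  have le': "\<forall>u\<in>set (p @ [(c, 3 - b)]). e * fst u \<le> e * c"
    using le by simp
  have "walk_width ((p @ [(c, 3 - b)]) @ [(c + e, 3 - b)]) = int (Suc w)"
    using walk_width_snoc_new_column[of e c "p @ [(c, 3 - b)]" "3 - b"] assms(4) le' w' by auto
  then show "walk_width (p @ [(c, 3 - b), (c + e, 3 - b)]) = int (Suc w)"
    by simp
  have lt: "e * fst u < e * (c + e)" if "u \<in> set p" for u
    using bspec[OF le that] assms(4) by auto
  have "i = 0 \<or> i = 1" if "i \<in> {0..1}" for i :: int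
    using that by auto
  then have "(c + e - e * i, 3 - b) \<in> set (p @ [(c, 3 - b), (c + e, 3 - b)])"
    if "i \<in> {0..1}" for i
    using that by force
  moreover have "3 - (3 - b) = b" "3 - b \<in> {1, 2}"
    using assms(3) by auto
  ultimately show "front e 0 (c + e) (3 - b) (p @ [(c, 3 - b), (c + e, 3 - b)])"
    using assms(2,4) lt cb unfolding front_def by auto
qed

text \<open>
  The recurrence for fronts. The walk moves on (to \<open>p1\<close>) or changes rows. After changing rows it
  must move on (to \<open>p2\<close>) if \<open>r = 0\<close>; otherwise it may also turn back, and the
  remaining \<open>r - 1\<close> steps in the dead end give the term \<open>x\<^sup>r\<^sup>-\<^sup>1 y\<^sup>w\<close>.
\<close>
lemma completion_gf_front:
  assumes F: "front e r c b p" and w: "walk_width p = int w"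
  shows "\<exists>p1 p2 c1 c2 b2. front e (Suc r) c1 b p1 \<and> front e 0 c2 b2 p2
    \<and> walk_width p1 = int (Suc w) \<and> walk_width p2 = int (Suc w)
    \<and> (if r = 0 then 2 * completion_gf p = X * completion_gf p1 + X ^ 2 * completion_gf p2
       else 4 * completion_gf p
         = 2 * X * completion_gf p1 + X ^ 2 * (completion_gf p2 + X ^ (r - 1) * Y ^ w))"
proof -
  have F': "p \<noteq> []" "last p = (c, b)" and b: "b \<in> {1, 2}" and e: "e \<in> {1, -1}"
    and edge: "\<forall>u\<in>set p. u = (c, b) \<or> e * fst u < e * c"
    and row: "\<forall>i\<in>{0..int r + 1}. (c - e * i, b) \<in> set p"
    and gap: "\<forall>i\<in>{1..int r}. (c - e * i, 3 - b) \<notin> set p"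
    and wall: "(c - e * (int r + 1), 3 - b) \<in> set p"
    using F unfolding front_def by blast+
  let ?p1 = "p @ [(c + e, b)]" and ?q = "p @ [(c, 3 - b)]"
    and ?p2 = "p @ [(c, 3 - b), (c + e, 3 - b)]"
  have le: "\<forall>u\<in>set p. e * fst u \<le> e * c"
    using edge by force
  note sw = front_after_switch[OF F'(2,1) b e le w]
  have b': "3 - b \<noteq> b" "3 - (3 - b) = b" "3 - b \<in> {1, 2}" using b by auto
  have e0: "e \<noteq> 0" using e by auto
  have new: "(c + e, b'') \<notin> set p" for b''
    using le e by force
  have across: "(c, 3 - b) \<notin> set p"
    using edge b' by force
  have behind: "(c - e * i, b) \<in> set p" if "0 \<le> i" "i \<le> int r + 1" for i
    using that by (intro bspec[OF row]) simp
  have cb: "(c, b) \<in> set p" "(c - e, b) \<in> set p"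
    using behind[of 0] behind[of 1] by simp_all
  have "free_nbrs p = {(c + e, b), (c, 3 - b)}"
    using new across cb by (subst free_nbrs_ladder[OF F'(2) b e]) auto
  then have gp: "2 * completion_gf p = X * (completion_gf ?p1 + completion_gf ?q)"
    using completion_gf_step[of p] e0 by simp
  have last_q: "last ?q = (c, 3 - b)" by simp
  have gq: "completion_gf ?q = X * completion_gf ?p2" if "r = 0"
  proof -
    have "(c - e, 3 - b) \<in> set p" using wall that by simp
    then have "free_nbrs ?q = {(c + e, 3 - b)}"
      using new cb b' e0
      by (subst free_nbrs_ladder[OF last_q b'(3) e]) auto
    then show ?thesis
      using completion_gf_step[of ?q] by simp
  qed
  have gq': "2 * completion_gf ?q = X * (completion_gf ?p2 + X ^ (r - 1) * Y ^ w)" if "r \<noteq> 0"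
  proof -
    let ?t = "?q @ [(c - e, 3 - b)]"
    have gap': "(c - e * i, 3 - b) \<notin> set p" if "1 \<le> i" "i \<le> int r" for i
      using that by (intro bspec[OF gap]) simp
    have "(c - e, 3 - b) \<notin> set p" using gap'[of 1] that by simp
    then have "free_nbrs ?q = {(c + e, 3 - b), (c - e, 3 - b)}"
      using new cb b' e0
      by (subst free_nbrs_ladder[OF last_q b'(3) e]) auto
    moreover have "(c + e, 3 - b) \<noteq> (c - e, 3 - b)" using e0 by simp
    ultimately have g: "2 * completion_gf ?q = X * (completion_gf ?p2 + completion_gf ?t)"
      using completion_gf_step[of ?q] by simp
    have "(c - e + - e * i, 3 - b) \<notin> set ?t" if i: "i \<in> {1..int (r - 1)}" for i
    proof -
      have "(c - e * (i + 1), 3 - b) \<notin> set p"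
        using i by (intro gap') auto
      moreover have "e * (i + 1) \<noteq> 0" "e * i \<noteq> 0" using e0 i by auto
      ultimately show ?thesis by (simp add: algebra_simps)
    qed
    moreover have "(c - e + - e * i, 3 - (3 - b)) \<in> set ?t" if i: "i \<in> {0..int (r - 1)}" for i
    proof -
      have "(c - e * (i + 1), b) \<in> set p"
        using i by (intro behind) auto
      then show ?thesis unfolding b' by (simp add: algebra_simps)
    qed
    ultimately have "corridor (- e) (r - 1) (c - e) (3 - b) ?t"
      using e b'(3) unfolding corridor_def by (intro conjI ballI) auto
    moreover have "(c - e + - e * (int (r - 1) + 1), 3 - b) \<in> set ?t"
      using wall that by (simp add: algebra_simps of_nat_diff)
    moreover have "walk_width ?t = int w"
    proof -
      have "fst (c - e, 3 - b) \<in> fst ` set ?q"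
        using cb(2) by (intro image_eqI[of _ _ "(c - e, b)"]) simp_all
      then show ?thesis
        using walk_width_snoc_old_column sw(3) by metis
    qed
    ultimately show ?thesis
      using g completion_gf_dead_end by metis
  qed
  have "if r = 0 then 2 * completion_gf p = X * completion_gf ?p1 + X ^ 2 * completion_gf ?p2
       else 4 * completion_gf p
         = 2 * X * completion_gf ?p1 + X ^ 2 * (completion_gf ?p2 + X ^ (r - 1) * Y ^ w)"
  proof (cases "r = 0")
    case True
    then show ?thesis using gp gq by (simp add: algebra_simps power2_eq_square)
  next
    case False
    have "4 * completion_gf p = 2 * (2 * completion_gf p)" by simp
    also have "\<dots> = 2 * X * completion_gf ?p1 + X * (2 * completion_gf ?q)"
      unfolding gp by (simp add: algebra_simps)
    finally show ?thesis
      using False gq' by (simp add: algebra_simps power2_eq_square)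
  qed
  moreover have "walk_width ?p1 = int (Suc w)"
    using front_advance(2)[OF F] w by simp
  moreover have "front e 0 (c + e) (3 - b) ?p2" "walk_width ?p2 = int (Suc w)"
    using sw(1,2) .
  ultimately show ?thesis
    using front_advance(1)[OF F] by (intro exI conjI)
qed

text \<open>
  The walk so far consists of \<open>k\<close> steps in direction \<open>e\<close>. The case \<open>k = 0\<close> is excluded because
  the starting vertex has three free neighbours instead of two.
\<close>
definition straight :: "int \<Rightarrow> nat \<Rightarrow> int \<Rightarrow> nat \<Rightarrow> (int \<times> nat) list \<Rightarrow> bool" where
  "straight e k c b p \<longleftrightarrow> 0 < k \<and> p \<noteq> [] \<and> last p = (c, b) \<and> b \<in> {1, 2} \<and> e \<in> {1, -1}
     \<and> set p = (\<lambda>i. (c - e * i, b)) ` {0..int k}"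

text \<open>
  The recurrence for straight beginnings. In contrast to a front, turning back (after changing
  rows) is not fatal: the walk runs through the other row, leaves on the far side of its starting
  point and becomes a front (\<open>p3\<close>) with the opposite direction.
\<close>
lemma completion_gf_straight:
  assumes S: "straight e k c b p" and w: "walk_width p = int w"
  shows "\<exists>p1 p2 p3 c1 c2 c3 b2. straight e (Suc k) c1 b p1
    \<and> front e 0 c2 b2 p2 \<and> front (- e) 0 c3 b2 p3
    \<and> walk_width p1 = int (Suc w) \<and> walk_width p2 = int (Suc w) \<and> walk_width p3 = int (Suc w)
    \<and> 4 * completion_gf p
       = 2 * X * completion_gf p1 + X ^ 2 * (completion_gf p2 + X ^ k * completion_gf p3)"
proof -
  have k: "0 < k" and p: "p \<noteq> []" "last p = (c, b)" and b: "b \<in> {1, 2}" and e: "e \<in> {1, -1}"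
    and set_p: "set p = (\<lambda>i. (c - e * i, b)) ` {0..int k}"
    using S unfolding straight_def by blast+
  let ?p1 = "p @ [(c + e, b)]" and ?q = "p @ [(c, 3 - b)]"
    and ?p2 = "p @ [(c, 3 - b), (c + e, 3 - b)]"
  let ?t = "?q @ [(c - e, 3 - b)]"
  have e0: "e \<noteq> 0" and ee: "e * e = 1" using e by auto
  have b': "3 - b \<noteq> b" "3 - (3 - b) = b" "3 - b \<in> {1, 2}" using b by auto
  have row: "(c - e * i, b) \<in> set p" if "i \<in> {0..int k}" for i
    unfolding set_p using that by (rule imageI)
  have cb: "(c, b) \<in> set p" "(c - e, b) \<in> set p"
    using row[of 0] row[of 1] k by simp_all
  have across: "(c', 3 - b) \<notin> set p" for c'
    unfolding set_p using b' by auto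
  have dist: "\<exists>i. u = (c - e * i, b) \<and> e * fst u = e * c - i \<and> 0 \<le> i \<and> i \<le> int k"
    if "u \<in> set p" for u
  proof -
    obtain i where "u = (c - e * i, b)" "i \<in> {0..int k}"
      using \<open>u \<in> set p\<close> unfolding set_p by (rule imageE)
    moreover have "e * (c - e * i) = e * c - (e * e) * i"
      by (simp add: algebra_simps)
    ultimately show ?thesis using ee by auto
  qed
  have le: "\<forall>u\<in>set p. e * fst u \<le> e * c"
    using dist by force
  have new: "(c + e, b) \<notin> set p"
    using le e by force
  have "free_nbrs p = {(c + e, b), (c, 3 - b)}"
    using new across cb by (subst free_nbrs_ladder[OF p(2) b e]) auto
  then have gp: "2 * completion_gf p = X * (completion_gf ?p1 + completion_gf ?q)"
    using completion_gf_step[of p] e0 by simp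
  have last_q: "last ?q = (c, 3 - b)" by simp
  have "free_nbrs ?q = {(c + e, 3 - b), (c - e, 3 - b)}"
    using across cb b' e0
    by (subst free_nbrs_ladder[OF last_q b'(3) e]) auto
  moreover have "(c + e, 3 - b) \<noteq> (c - e, 3 - b)" using e0 by simp
  ultimately have gq: "2 * completion_gf ?q = X * (completion_gf ?p2 + completion_gf ?t)"
    using completion_gf_step[of ?q] by simp
  note sw = front_after_switch[OF p(2,1) b e le w]
  have "fst (c - e, 3 - b) \<in> fst ` set ?q"
    using cb(2) by (intro image_eqI[of _ _ "(c - e, b)"]) simp_all
  then have wt: "walk_width ?t = int w"
    using walk_width_snoc_old_column sw(3) by metis
  have "(c - e + - e * i, 3 - b) \<notin> set ?t" if i: "i \<in> {1..int (k - 1)}" for i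
  proof -
    have "e * (i + 1) \<noteq> 0" "e * i \<noteq> 0" using e0 i by auto
    then show ?thesis using across by (simp add: algebra_simps)
  qed
  moreover have "(c - e + - e * i, 3 - (3 - b)) \<in> set ?t" if i: "i \<in> {0..int (k - 1)}" for i
  proof -
    have "(c - e * (i + 1), b) \<in> set p"
      using i k by (intro row) auto
    then show ?thesis unfolding b' by (simp add: algebra_simps)
  qed
  ultimately have cor: "corridor (- e) (k - 1) (c - e) (3 - b) ?t"
    using e b'(3) unfolding corridor_def by (intro conjI ballI) auto
  \<comment> \<open>The corridor ends in the column of the starting vertex, \<open>k\<close> columns behind the current one.\<close>
  have end_col: "- e * (c - e + - e * int (k - 1)) = - (e * c) + int k"
  proof -
    have "- e * (c - e + - e * int (k - 1)) = - (e * c) + (e * e) * (1 + int (k - 1))"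
      by (simp add: algebra_simps)
    then show ?thesis using ee k by simp
  qed
  have bound: "\<forall>u\<in>set ?t. - e * fst u \<le> - e * (c - e + - e * int (k - 1))"
    unfolding end_col
  proof
    fix u assume "u \<in> set ?t"
    then consider "u \<in> set p" | "u = (c, 3 - b)" | "u = (c - e, 3 - b)" by auto
    then show "- e * fst u \<le> - (e * c) + int k"
    proof cases
      case 1
      then show ?thesis using dist[of u] by auto
    next
      case 2
      then show ?thesis by simp
    next
      case 3
      then have "- e * fst u = - (e * c) + e * e" by (simp add: algebra_simps)
      then show ?thesis using ee k by simp
    qed
  qed
  obtain p3 c3 where p3: "front (- e) 0 c3 (3 - b) p3" "walk_width p3 = int (Suc w)"
    "completion_gf ?t = X ^ k * completion_gf p3"
    using completion_gf_escape[OF cor bound wt] k by auto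
  have "4 * completion_gf p = 2 * (2 * completion_gf p)" by simp
  also have "\<dots> = 2 * X * completion_gf ?p1 + X * (2 * completion_gf ?q)"
    unfolding gp by (simp add: algebra_simps)
  also have "X * (2 * completion_gf ?q)
      = X ^ 2 * (completion_gf ?p2 + X ^ k * completion_gf p3)"
    unfolding gq p3(3) by (simp add: power2_eq_square mult.assoc)
  finally have gf: "4 * completion_gf p = 2 * X * completion_gf ?p1
      + X ^ 2 * (completion_gf ?p2 + X ^ k * completion_gf p3)" .
  have "c \<in> fst ` set p"
    using cb(1) by (rule image_eqI[rotated]) simp
  then have w1: "walk_width ?p1 = int (Suc w)"
    using walk_width_snoc_new_column[OF e _ le] w by simp
  have "{0..int (Suc k)} = insert 0 ((\<lambda>i. i + 1) ` {0..int k})"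
    by (auto simp: image_iff intro!: bexI[of _ "_ - 1"])
  then have "set ?p1 = (\<lambda>i. (c + e - e * i, b)) ` {0..int (Suc k)}"
    unfolding \<open>{0..int (Suc k)} = _\<close> image_insert image_image by (simp add: set_p algebra_simps)
  then have "straight e (Suc k) (c + e) b ?p1"
    using b e unfolding straight_def by simp
  then show ?thesis
    using sw(1,2) p3(1,2) gf w1 by (intro exI conjI)
qed

section \<open>Solving the recurrences\<close>

text \<open>The recurrences determine only multiples of the unknown series by \<open>2\<close> and \<open>4\<close>, which are units.\<close>
lemma fps_X_power_dvd_cancel_numeral:
  assumes "fps_X ^ n dvd numeral m * (F :: real fps fps)"
  shows "fps_X ^ n dvd F"
proof -
  have "fps_const (fps_const (1 / numeral m)) * (numeral m :: real fps fps) = 1"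
    by (simp add: numeral_fps_const)
  then have "F = fps_const (fps_const (1 / numeral m)) * (numeral m * F)"
    by (simp add: mult.assoc[symmetric])
  then show ?thesis
    using assms dvd_mult by metis
qed

lemma fps_eq_0_if_X_powers_dvd:
  fixes F :: "'a::comm_ring_1 fps"
  assumes "\<And>n. fps_X ^ n dvd F"
  shows "F = 0"
proof (rule fps_ext)
  fix m
  obtain G where "F = fps_X ^ Suc m * G"
    using assms[of "Suc m"] by (elim dvdE)
  then show "fps_nth F m = fps_nth 0 m"
    by (simp only: fps_X_power_mult_nth) simp
qed

text \<open>
  Iterating the recurrences for \<open>R\<^sub>r\<close> and \<open>S\<^sub>k\<close> produces geometric series with ratios \<open>x y / 2\<close>
  and \<open>x\<^sup>2 y / 2\<close>. They contribute the denominators \<open>a = 2 - x y\<close> and \<open>b = 2 - x\<^sup>2 y\<close>. With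
  \<open>R\<^sub>1 = x\<^sup>2 y R\<^sub>0 / (2 a) + x\<^sup>2 / (2 b)\<close>, solving the equation for \<open>R\<^sub>0\<close> introduces
  the third denominator \<open>d = 2 a b - x\<^sup>3 y\<^sup>2\<close>.
\<close>
definition pole_a :: "'a::idom \<Rightarrow> 'a \<Rightarrow> 'a" where "pole_a x y = 2 - x * y"
definition pole_b :: "'a::idom \<Rightarrow> 'a \<Rightarrow> 'a" where "pole_b x y = 2 - x ^ 2 * y"
definition pole_d :: "'a::idom \<Rightarrow> 'a \<Rightarrow> 'a" where
  "pole_d x y = x ^ 3 * y ^ 2 - 4 * x ^ 2 * y - 4 * x * y + 8"

text \<open>
  The solution is \<open>R\<^sub>r = front_num r / (2 b d)\<close> and \<open>S\<^sub>k = straight_num k / (2 b\<^sup>2 d)\<close>. The case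
  \<open>r = 0\<close> is separate because a front with \<open>r = 0\<close> cannot turn back: after a
  change of rows the step forward is forced, and there is no trapping term.
\<close>
definition front_num :: "nat \<Rightarrow> 'a::idom \<Rightarrow> 'a \<Rightarrow> 'a" where
  "front_num r x y = (if r = 0 then 2 * x ^ 3 * y * pole_a x y
     else x ^ 5 * y ^ 2 + x ^ Suc r * pole_d x y)"

definition straight_num :: "nat \<Rightarrow> 'a::idom \<Rightarrow> 'a \<Rightarrow> 'a" where
  "straight_num k x y = x ^ 5 * y ^ 2 * (pole_b x y + x ^ k * pole_a x y)"

lemma front_num_0:
  "2 * front_num 0 x y = x * y * front_num 1 x y + x ^ 2 * y * front_num 0 x y"
  unfolding front_num_def pole_a_def pole_d_def by (simp, algebra)

lemma front_num_pos:
  assumes "r \<noteq> 0"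
  shows "4 * front_num r x y = 2 * x * y * front_num (Suc r) x y
    + x ^ 2 * (y * front_num 0 x y + x ^ (r - 1) * (2 * pole_b x y * pole_d x y))"
proof -
  obtain s where s: "r = Suc s" using assms not0_implies_Suc by blast
  define z where "z = x ^ s"
  have "x ^ Suc r = x ^ 2 * z" "x ^ Suc (Suc r) = x ^ 3 * z" "x ^ (r - 1) = z"
    by (simp_all add: s z_def eval_nat_numeral mult_ac)
  then have nums: "front_num r x y = x ^ 5 * y ^ 2 + x ^ 2 * z * pole_d x y"
    "front_num (Suc r) x y = x ^ 5 * y ^ 2 + x ^ 3 * z * pole_d x y"
    "front_num 0 x y = 2 * x ^ 3 * y * pole_a x y" "x ^ (r - 1) = z"
    using assms by (simp_all add: front_num_def)
  show ?thesis
    unfolding nums pole_a_def pole_b_def pole_d_def by algebra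
qed

lemma straight_num_rec:
  "4 * straight_num k x y = 2 * x * y * straight_num (Suc k) x y
    + x ^ 2 * (y * pole_b x y * front_num 0 x y + x ^ k * (y * pole_b x y * front_num 0 x y))"
  unfolding straight_num_def front_num_def pole_a_def pole_b_def by (simp, algebra)

text \<open>
  Uniqueness of the solution: by linearity, the error \<open>2 b d G p - y ^ w N\<^sub>r\<close> (with \<open>N\<^sub>r\<close> the
  numerator) satisfies the homogeneous recurrence. It is thus \<open>x\<close> times a combination of errors
  at other fronts, and is divisible by every power of \<open>x\<close>.
\<close>
lemma front_gf_mod:
  assumes "front e r c b p" "walk_width p = int w"
  shows "X ^ n dvd 2 * pole_b X Y * pole_d X Y * completion_gf p - Y ^ w * front_num r X Y"
  using assms
proof (induction n arbitrary: e r c b p w)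
  case (Suc n)
  define K where "K = 2 * pole_b X Y * pole_d X Y"
  define N where "N r = front_num r X Y" for r
  obtain p1 p2 c1 c2 b2 where p1: "front e (Suc r) c1 b p1" "walk_width p1 = int (Suc w)"
    and p2: "front e 0 c2 b2 p2" "walk_width p2 = int (Suc w)"
    and rec: "if r = 0 then 2 * completion_gf p = X * completion_gf p1 + X ^ 2 * completion_gf p2
       else 4 * completion_gf p
         = 2 * X * completion_gf p1 + X ^ 2 * (completion_gf p2 + X ^ (r - 1) * Y ^ w)"
    using completion_gf_front[OF Suc.prems] by blast
  let ?d = "K * completion_gf p - Y ^ w * N r"
  let ?d1 = "K * completion_gf p1 - Y ^ Suc w * N (Suc r)"
  let ?d2 = "K * completion_gf p2 - Y ^ Suc w * N 0"
  have IH: "X ^ n dvd ?d1" "X ^ n dvd ?d2"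
    using Suc.IH[OF p1] Suc.IH[OF p2] unfolding K_def N_def by simp_all
  have "X ^ Suc n dvd ?d"
  proof (cases "r = 0")
    case True
    have r: "2 * completion_gf p = X * completion_gf p1 + X ^ 2 * completion_gf p2"
      using rec True by simp
    have N: "2 * N 0 = X * Y * N 1 + X ^ 2 * Y * N 0"
      unfolding N_def by (rule front_num_0)
    have "2 * ?d = K * (2 * completion_gf p) - Y ^ w * (2 * N 0)"
      using True by (simp add: algebra_simps)
    also have "\<dots> = X * (?d1 + X * ?d2)"
      unfolding r N using True by (simp add: algebra_simps power2_eq_square del: fps_const_mult fps_const_power)
    finally have "X ^ Suc n dvd 2 * ?d"
      unfolding power_Suc[of X n] by (simp only: mult_dvd_mono dvd_refl dvd_add dvd_mult IH)
    then show ?thesis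
      by (rule fps_X_power_dvd_cancel_numeral)
  next
    case False
    have r: "4 * completion_gf p
         = 2 * X * completion_gf p1 + X ^ 2 * (completion_gf p2 + X ^ (r - 1) * Y ^ w)"
      using rec False by simp
    have N: "4 * N r = 2 * X * Y * N (Suc r) + X ^ 2 * (Y * N 0 + X ^ (r - 1) * K)"
      unfolding N_def K_def by (rule front_num_pos[OF False])
    have "4 * ?d = K * (4 * completion_gf p) - Y ^ w * (4 * N r)"
      by (simp add: algebra_simps)
    also have "\<dots> = X * (2 * ?d1 + X * ?d2)"
      unfolding r N by (simp add: algebra_simps power2_eq_square del: fps_const_mult fps_const_power)
    finally have "X ^ Suc n dvd 4 * ?d"
      unfolding power_Suc[of X n] by (simp only: mult_dvd_mono dvd_refl dvd_add dvd_mult IH)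
    then show ?thesis
      by (rule fps_X_power_dvd_cancel_numeral)
  qed
  then show ?case unfolding K_def N_def .
qed simp

lemma front_gf:
  assumes "front e r c b p" "walk_width p = int w"
  shows "2 * pole_b X Y * pole_d X Y * completion_gf p = Y ^ w * front_num r X Y"
  using fps_eq_0_if_X_powers_dvd[OF front_gf_mod[OF assms]] by simp

text \<open>
  The same argument; the terms for the fronts are already known exactly, so only the error at
  the longer straight walk remains.
\<close>
lemma straight_gf_mod:
  assumes "straight e k c b p" "walk_width p = int w"
  shows "X ^ n dvd 2 * pole_b X Y ^ 2 * pole_d X Y * completion_gf p - Y ^ w * straight_num k X Y"
  using assms
proof (induction n arbitrary: k c p w)
  case (Suc n)
  define P where "P = pole_b X Y"
  define K where "K = 2 * P * pole_d X Y"
  define N where "N = front_num 0 X Y"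
  define M where "M k = straight_num k X Y" for k
  obtain p1 p2 p3 c1 c2 c3 b2 where p1: "straight e (Suc k) c1 b p1" "walk_width p1 = int (Suc w)"
    and p2: "front e 0 c2 b2 p2" "walk_width p2 = int (Suc w)"
    and p3: "front (- e) 0 c3 b2 p3" "walk_width p3 = int (Suc w)"
    and r: "4 * completion_gf p
       = 2 * X * completion_gf p1 + X ^ 2 * (completion_gf p2 + X ^ k * completion_gf p3)"
    using completion_gf_straight[OF Suc.prems] by blast
  have K: "2 * pole_b X Y ^ 2 * pole_d X Y = K * P"
    unfolding K_def P_def by (simp add: power2_eq_square mult_ac)
  let ?d = "K * P * completion_gf p - Y ^ w * M k"
  let ?d1 = "K * P * completion_gf p1 - Y ^ Suc w * M (Suc k)"
  have IH: "X ^ n dvd ?d1"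
    using Suc.IH[OF p1] unfolding K M_def .
  have f: "K * completion_gf p2 = Y ^ Suc w * N" "K * completion_gf p3 = Y ^ Suc w * N"
    using front_gf[OF p2] front_gf[OF p3] unfolding K_def N_def P_def by simp_all
  have M: "4 * M k = 2 * X * Y * M (Suc k) + X ^ 2 * (Y * P * N + X ^ k * (Y * P * N))"
    unfolding M_def P_def N_def by (rule straight_num_rec)
  have "4 * ?d = K * P * (4 * completion_gf p) - Y ^ w * (4 * M k)"
    by (simp add: algebra_simps)
  also have "\<dots> = 2 * X * (K * P * completion_gf p1)
      + X ^ 2 * P * (K * completion_gf p2 + X ^ k * (K * completion_gf p3)) - Y ^ w * (4 * M k)"
    unfolding r by (simp add: algebra_simps)
  also have "\<dots> = X * (2 * ?d1)"
    unfolding f M by (simp add: algebra_simps power2_eq_square del: fps_const_mult fps_const_power)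
  finally have "X ^ Suc n dvd 4 * ?d"
    unfolding power_Suc[of X n] by (simp only: mult_dvd_mono dvd_refl dvd_mult IH)
  then have "X ^ Suc n dvd ?d"
    by (rule fps_X_power_dvd_cancel_numeral)
  then show ?case unfolding K M_def .
qed simp

lemma straight_gf:
  assumes "straight e k c b p" "walk_width p = int w"
  shows "2 * pole_b X Y ^ 2 * pole_d X Y * completion_gf p = Y ^ w * straight_num k X Y"
  using fps_eq_0_if_X_powers_dvd[OF straight_gf_mod[OF assms]] by simp

text \<open>
  The factor \<open>6 = 3 * 2\<close> combines the three choices at the starting vertex with the two choices
  after a first step across the ladder.
\<close>
lemma completion_gf_start:
  assumes b: "b \<in> {1, 2}"
  shows "\<exists>p1 p2 p3 p4 c3 c4. straight 1 1 (a + 1) b p1 \<and> straight (-1) 1 (a - 1) b p2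
    \<and> front 1 0 c3 (3 - b) p3 \<and> front (-1) 0 c4 (3 - b) p4
    \<and> (\<forall>p\<in>{p1, p2, p3, p4}. walk_width p = int 1)
    \<and> 6 * completion_gf [(a, b)] = 2 * X * (completion_gf p1 + completion_gf p2)
      + X ^ 2 * (completion_gf p3 + completion_gf p4)"
proof -
  let ?v = "[(a, b)]"
  let ?q = "?v @ [(a, 3 - b)]"
  have b': "3 - b \<noteq> b" "3 - (3 - b) = b" "3 - b \<in> {1, 2}" using b by auto
  have lv: "last ?v = (a, b)" and lq: "last ?q = (a, 3 - b)" by simp_all
  have one: "(1::int) \<in> {1, -1}" "(-1::int) \<in> {1, -1}" by auto
  have w: "walk_width ?v = int 0" by (simp add: walk_width_def)
  have "free_nbrs ?v = {(a + 1, b), (a - 1, b), (a, 3 - b)}"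
    by (subst free_nbrs_ladder[OF lv b one(1)]) (use b' in auto)
  then have gv: "3 * completion_gf ?v = X * (completion_gf (?v @ [(a + 1, b)])
      + completion_gf (?v @ [(a + -1, b)]) + completion_gf ?q)"
    using completion_gf_step[of ?v] b' by (simp add: add_ac)
  have "free_nbrs ?q = {(a + 1, 3 - b), (a - 1, 3 - b)}"
    by (subst free_nbrs_ladder[OF lq b'(3) one(1)]) (use b' in auto)
  then have gq: "2 * completion_gf ?q = X * (completion_gf (?v @ [(a, 3 - b), (a + 1, 3 - b)])
      + completion_gf (?v @ [(a, 3 - b), (a + -1, 3 - b)]))"
    using completion_gf_step[of ?q] by simp
  have st: "straight e 1 (a + e) b (?v @ [(a + e, b)])" if "e \<in> {1, -1}" for e
  proof -
    have "{0..int 1} = {0, 1}" by auto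
    then show ?thesis using b that unfolding straight_def by auto
  qed
  have wst: "walk_width (?v @ [(a + e, b)]) = int 1" if "e \<in> {1, -1}" for e
    using walk_width_snoc_new_column[OF that, of a ?v b] w by simp
  have sw: "front e 0 (a + e) (3 - b) (?v @ [(a, 3 - b), (a + e, 3 - b)])"
    "walk_width (?v @ [(a, 3 - b), (a + e, 3 - b)]) = int 1" if "e \<in> {1, -1}" for e
    using front_after_switch[OF lv _ b that _ w] by simp_all
  have "6 * completion_gf ?v = 2 * (3 * completion_gf ?v)" by simp
  also have "\<dots> = 2 * X * (completion_gf (?v @ [(a + 1, b)]) + completion_gf (?v @ [(a + -1, b)]))
      + X * (2 * completion_gf ?q)"
    unfolding gv by (simp add: algebra_simps)
  also have "X * (2 * completion_gf ?q)
      = X ^ 2 * (completion_gf (?v @ [(a, 3 - b), (a + 1, 3 - b)])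
        + completion_gf (?v @ [(a, 3 - b), (a + -1, 3 - b)]))"
    unfolding gq by (simp add: power2_eq_square mult.assoc)
  finally have gf: "6 * completion_gf ?v
    = 2 * X * (completion_gf (?v @ [(a + 1, b)]) + completion_gf (?v @ [(a + -1, b)]))
      + X ^ 2 * (completion_gf (?v @ [(a, 3 - b), (a + 1, 3 - b)])
        + completion_gf (?v @ [(a, 3 - b), (a + -1, 3 - b)]))" .
  have "straight (-1) 1 (a - 1) b (?v @ [(a + -1, b)])"
    using st[OF one(2)] by simp
  moreover have "\<forall>p\<in>{?v @ [(a + 1, b)], ?v @ [(a + -1, b)], ?v @ [(a, 3 - b), (a + 1, 3 - b)],
      ?v @ [(a, 3 - b), (a + -1, 3 - b)]}. walk_width p = int 1"
    unfolding ball_simps using wst[OF one(1)] wst[OF one(2)] sw(2)[OF one(1)] sw(2)[OF one(2)]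
    by blast
  ultimately show ?thesis
    using st[OF one(1)] sw(1)[OF one(1)] sw(1)[OF one(2)] gf by (intro exI conjI)
qed

text \<open>
  Where the final numerator comes from: the bracket \<open>x y b + x\<^sup>2 y a + a b\<close> that remains after
  extracting monomials equals \<open>4 - (2 - a) (2 - b) = 4 - x\<^sup>3 y\<^sup>2\<close>.
\<close>
lemma start_num:
  fixes x y :: "'a::idom"
  shows "2 * x * (2 * (y * straight_num 1 x y)) + x ^ 2 * (2 * (pole_b x y * (y * front_num 0 x y)))
    = 4 * (x ^ 5 * y ^ 2 * (4 - x ^ 3 * y ^ 2))"
  unfolding straight_num_def front_num_def pole_a_def pole_b_def by (simp, algebra)

theorem theorem2p20:
  fixes v :: "int \<times> nat"
  assumes "v \<in> ladder_verts"
  shows "ladder_gf v =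
    (X ^ 5 * Y ^ 2 * (4 - X ^ 3 * Y ^ 2)) /
    (3 * (X ^ 2 * Y - 2) ^ 2 * (X ^ 3 * Y ^ 2 - 4 * X ^ 2 * Y - 4 * X * Y + 8))"
proof -
  obtain a b where v: "v = (a, b)" and b: "b \<in> {1, 2}"
    using assms by (auto simp: ladder_verts_def)
  define P where "P = pole_b X Y"
  define K where "K = 2 * P * pole_d X Y"
  obtain p1 p2 p3 p4 c3 c4 where p: "straight 1 1 (a + 1) b p1" "straight (-1) 1 (a - 1) b p2"
      "front 1 0 c3 (3 - b) p3" "front (-1) 0 c4 (3 - b) p4"
    and w: "walk_width p1 = int 1" "walk_width p2 = int 1" "walk_width p3 = int 1"
      "walk_width p4 = int 1"
    and gf: "6 * completion_gf [(a, b)] = 2 * X * (completion_gf p1 + completion_gf p2)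
      + X ^ 2 * (completion_gf p3 + completion_gf p4)"
    using completion_gf_start[OF b, of a] by blast
  have KP: "2 * pole_b X Y ^ 2 * pole_d X Y = K * P"
    unfolding K_def P_def by (simp add: power2_eq_square mult_ac)
  have s: "K * P * completion_gf p1 = Y * straight_num 1 X Y"
    "K * P * completion_gf p2 = Y * straight_num 1 X Y"
    using straight_gf[OF p(1) w(1)] straight_gf[OF p(2) w(2)] unfolding KP power_one_right .
  have f: "K * completion_gf p3 = Y * front_num 0 X Y"
    "K * completion_gf p4 = Y * front_num 0 X Y"
    using front_gf[OF p(3) w(3)] front_gf[OF p(4) w(4)]
    unfolding K_def P_def power_one_right .
  have "K * P * (6 * completion_gf [v])
      = 2 * X * (K * P * completion_gf p1 + K * P * completion_gf p2)
        + X ^ 2 * (P * (K * completion_gf p3) + P * (K * completion_gf p4))"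
    unfolding v gf by (simp add: algebra_simps)
  also have "\<dots> = 2 * X * (2 * (Y * straight_num 1 X Y))
      + X ^ 2 * (2 * (P * (Y * front_num 0 X Y)))"
    unfolding s f mult_2 ..
  also have "\<dots> = 4 * (X ^ 5 * Y ^ 2 * (4 - X ^ 3 * Y ^ 2))"
    unfolding P_def by (rule start_num)
  finally have main: "K * P * (6 * completion_gf [v]) = 4 * (X ^ 5 * Y ^ 2 * (4 - X ^ 3 * Y ^ 2))" .
  have "4 * (ladder_gf v *
      (3 * (X ^ 2 * Y - 2) ^ 2 * (X ^ 3 * Y ^ 2 - 4 * X ^ 2 * Y - 4 * X * Y + 8)))
    = K * P * (6 * completion_gf [v])"
  proof -
    have P2: "(X ^ 2 * Y - 2) ^ 2 = P ^ 2"
      unfolding P_def pole_b_def by (rule power2_commute)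
    show ?thesis
      unfolding ladder_gf_eq_completion_gf P2 K_def pole_d_def[symmetric]
      by (simp add: power2_eq_square mult_ac)
  qed
  then have "4 * (ladder_gf v *
      (3 * (X ^ 2 * Y - 2) ^ 2 * (X ^ 3 * Y ^ 2 - 4 * X ^ 2 * Y - 4 * X * Y + 8)))
    = 4 * (X ^ 5 * Y ^ 2 * (4 - X ^ 3 * Y ^ 2))"
    unfolding main .
  then have eq: "ladder_gf v *
      (3 * (X ^ 2 * Y - 2) ^ 2 * (X ^ 3 * Y ^ 2 - 4 * X ^ 2 * Y - 4 * X * Y + 8))
    = X ^ 5 * Y ^ 2 * (4 - X ^ 3 * Y ^ 2)"
    by (subst (asm) mult_cancel_left) simp
  show ?thesis
    by (subst bivariate_divide_eq_iff) (use eq in \<open>simp_all add: fps_nth_power_0\<close>)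
qed

end
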